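(* For all integers $j,k,n,r$ with $1\le j<k\le n$ and $r\ge 1$, \[ \begin{aligned} &\frac{1}{(k-1)!}\sum_{i=0}^{r+1}(i+k-1)!\binom{n-k}{i}{k+r+1\brace i+k}\\ &\quad=\frac{1}{(k-j-1)!}\sum_{i=0}^{r+1}(k-j-1+i)!\binom{n-k+j}{i}\sum_{l=k-2}^{k+r-1}{l-j+2\brace k-j+i}\\ &\qquad\qquad\times\sum_{s=0}^{k+r-l-1}\binom{n-k}{s}\frac{(s+j-1)!}{(j-1)!}{j+k+r-l-1\brace s+j}. \end{aligned} \]
   Context: ${a\brace b}$ denotes the Stirling number of the second kind: the number of ways to partition a set of $a$ elements into $b$ non-empty subsets; in particular ${a\brace b}=0$ for $a<b$. Binomial coefficients satisfy $\binom{N}{M}=0$ for integers $M>N\ge 0$. *)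

theory Defs
  imports Complex_Main "HOL-Combinatorics.Stirling"
begin

end

theory Submission
  imports Defs
begin

text \<open>
  Put \<open>m = n - k\<close> and \<open>R = r + 1\<close>. The left-hand side is the complete homogeneous symmetric
  polynomial \<open>h\<^sub>R\<close> evaluated at the \<open>k\<close> consecutive integers \<open>m + 1, \<dots>, m + k\<close>, that is, the
  coefficient of \<open>z ^ R\<close> in \<open>\<Prod>c = m + 1..m + k. 1 / (1 - c z)\<close>. The right-hand side is what one
  gets by cutting this product after its first \<open>j\<close> factors: with \<open>l = k - 2 + t\<close>, the sum over
  \<open>s\<close> is \<open>h\<close> of degree \<open>R - t\<close> at \<open>m + 1, \<dots>, m + j\<close>, the sum over \<open>i\<close>, divided by
  \<open>(k - j - 1)!\<close>, is \<open>h\<close> of degree \<open>t\<close> at \<open>m + j + 1, \<dots>, m + k\<close>, and the sum over \<open>t\<close> is the Cauchy product of the two.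

  So everything rests on \<open>sum_Stirling_eq_complete_hom\<close>, which evaluates
  \<open>\<Sum>i. (i + k - 1)! (m choose i) {k + R brace i + k}\<close> as \<open>(k - 1)!\<close> times \<open>h\<close>, and on
  \<open>complete_hom_add\<close>, the Cauchy product. The former holds because both sides satisfy the same
  recurrence in \<open>k\<close> and \<open>R\<close>; on the Stirling side it comes from the triangular recurrence of
  the Stirling numbers (\<open>sum_Stirling_rec\<close>).
\<close>

text \<open>
  The complete homogeneous symmetric polynomial of degree \<open>R\<close> in \<open>x 0, \<dots>, x (k - 1)\<close>. The last
  equation separates the monomials without the variable \<open>x k\<close> from the multiples of it.
\<close>

fun complete_hom :: "(nat \<Rightarrow> 'a::comm_semiring_1) \<Rightarrow> nat \<Rightarrow> nat \<Rightarrow> 'a" where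
  "complete_hom x k 0 = 1"
| "complete_hom x 0 (Suc R) = 0"
| "complete_hom x (Suc k) (Suc R) = complete_hom x k (Suc R) + x k * complete_hom x (Suc k) R"

text \<open>
  A monomial of degree \<open>R\<close> in \<open>j + a\<close> variables is uniquely a monomial in the last \<open>a\<close> variables
  times one in the first \<open>j\<close>; \<open>t\<close> is the degree of the former.
\<close>

lemma complete_hom_add:
  "complete_hom x (j + a) R =
    (\<Sum>t\<le>R. complete_hom (\<lambda>i. x (j + i)) a t * complete_hom x j (R - t))"
proof (induction a arbitrary: R)
  case 0
  have "complete_hom y 0 t = (if t = 0 then 1 else 0)" for t and y :: "nat \<Rightarrow> 'a"
    by (cases t) auto
  then show ?case by (simp add: if_distrib[of "\<lambda>c. c * _"] sum.delta cong: if_cong)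
next
  case (Suc a)
  note outer = Suc.IH
  let ?y = "\<lambda>i. x (j + i)"
  show ?case
  proof (induction R)
    case 0
    then show ?case by simp
  next
    case (Suc R)
    have "complete_hom x (j + Suc a) (Suc R)
        = complete_hom x (j + a) (Suc R) + x (j + a) * complete_hom x (j + Suc a) R"
      by simp
    also have "\<dots> = (\<Sum>t\<le>Suc R. complete_hom ?y a t * complete_hom x j (Suc R - t))
        + x (j + a) * (\<Sum>t\<le>R. complete_hom ?y (Suc a) t * complete_hom x j (R - t))"
      by (simp only: outer Suc)
    also have "\<dots> = complete_hom x j (Suc R)
        + (\<Sum>t\<le>R. complete_hom ?y a (Suc t) * complete_hom x j (R - t))
        + x (j + a) * (\<Sum>t\<le>R. complete_hom ?y (Suc a) t * complete_hom x j (R - t))"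
      by (simp only: sum.atMost_Suc_shift) simp
    also have "\<dots> = complete_hom x j (Suc R)
        + (\<Sum>t\<le>R. complete_hom ?y (Suc a) (Suc t) * complete_hom x j (R - t))"
      by (simp add: sum_distrib_left sum.distrib algebra_simps)
    also have "\<dots> = (\<Sum>t\<le>Suc R. complete_hom ?y (Suc a) t * complete_hom x j (Suc R - t))"
      by (simp only: sum.atMost_Suc_shift) simp
    finally show ?case .
  qed
qed

text \<open>
  Expanding the Stirling number on the left produces \<open>(i + k)! = k (i + k - 1)! + i (i + k - 1)!\<close>
  in front of \<open>{k + R + 1 brace i + k}\<close>. The first part is the first sum on the right. In the
  second, \<open>i (m choose i) = (m - i + 1) (m choose (i - 1))\<close> shifts \<open>i\<close> by one, and the factor
  \<open>m - i\<close> then completes the factor \<open>i + k + 1\<close> of the triangular recurrence to \<open>m + k + 1\<close>,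
  which does not depend on \<open>i\<close>.
\<close>

lemma sum_Stirling_rec:
  assumes "R < N"
  shows "(\<Sum>i\<le>N. fact (i + k) * (m choose i) * Stirling (k + R + 2) (i + k + 1))
    = k * (\<Sum>i\<le>N. fact (i + k - 1) * (m choose i) * Stirling (k + R + 1) (i + k))
      + (m + k + 1) * (\<Sum>i\<le>N. fact (i + k) * (m choose i) * Stirling (k + R + 1) (i + k + 1))"
    (is "?L = k * ?A + (m + k + 1) * ?B")
proof -
  obtain M where N: "N = Suc M" using assms by (cases N) auto
  let ?S = "Stirling (k + R + 1)"
  have fact_split: "fact (i + k) * ?S (i + k) = (k + i) * fact (i + k - 1) * ?S (i + k)" for i
    \<comment> \<open>If \<open>i + k = 0\<close> the factorials do not match, but \<open>{R + 1 brace 0} = 0\<close>.\<close>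
    by (cases "i + k") (auto simp: algebra_simps)
  have shift: "(\<Sum>i\<le>N. i * fact (i + k - 1) * (m choose i) * ?S (i + k))
      = (\<Sum>i\<le>N. (m - i) * (fact (i + k) * (m choose i) * ?S (i + k + 1)))" (is "?C = ?D")
  proof -
    have absorb: "Suc i * (m choose Suc i) = (m - i) * (m choose i)" for i
      by (metis binomial_absorption binomial_absorb_comp)
    have "?C = (\<Sum>i\<le>M. Suc i * (m choose Suc i) * (fact (i + k) * ?S (i + k + 1)))"
      unfolding N by (simp only: sum.atMost_Suc_shift) (simp add: algebra_simps)
    also have "\<dots> = (\<Sum>i\<le>M. (m - i) * (fact (i + k) * (m choose i) * ?S (i + k + 1)))"
      by (simp only: absorb) (simp only: ac_simps)
    also have "\<dots> = ?D"
      using assms unfolding N by simp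
    finally show ?thesis .
  qed
  have collect: "(i + k + 1) * (fact (i + k) * (m choose i) * ?S (i + k + 1))
      + (m - i) * (fact (i + k) * (m choose i) * ?S (i + k + 1))
      = (m + k + 1) * (fact (i + k) * (m choose i) * ?S (i + k + 1))" for i
  proof (cases "i \<le> m")
    case True
    then have "(i + k + 1) + (m - i) = m + k + 1" by simp
    then show ?thesis by (metis distrib_right)
  qed (simp add: binomial_eq_0)
  have "?L = (\<Sum>i\<le>N. (i + k + 1) * (fact (i + k) * (m choose i) * ?S (i + k + 1))
        + fact (i + k) * ?S (i + k) * (m choose i))"
    by (intro sum.cong) (simp_all add: algebra_simps)
  also have "\<dots> = (\<Sum>i\<le>N. (i + k + 1) * (fact (i + k) * (m choose i) * ?S (i + k + 1)))
      + (k * ?A + ?C)"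
    by (simp only: fact_split) (simp add: sum.distrib sum_distrib_left algebra_simps)
  also have "\<dots> = k * ?A + (\<Sum>i\<le>N. (i + k + 1) * (fact (i + k) * (m choose i) * ?S (i + k + 1))
      + (m - i) * (fact (i + k) * (m choose i) * ?S (i + k + 1)))"
    by (simp only: shift sum.distrib)
  also have "\<dots> = k * ?A + (m + k + 1) * ?B"
    by (simp only: collect sum_distrib_left)
  finally show ?thesis .
qed

text \<open>
  The upper limit may be any \<open>N \<ge> R\<close>, since the Stirling numbers vanish for \<open>i > R\<close>; keeping it
  separate from \<open>R\<close> lets the induction on \<open>R\<close> run with a fixed range of summation, and lets
  one range of \<open>i\<close> serve all degrees \<open>t\<close> of the Cauchy product.
\<close>

lemma sum_Stirling_eq_complete_hom:
  assumes "R \<le> N"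
  shows "(\<Sum>i\<le>N. fact (i + k) * (m choose i) * Stirling (Suc k + R) (i + Suc k))
    = fact k * complete_hom (\<lambda>i. m + 1 + i) (Suc k) R"
  using assms
proof (induction k arbitrary: R)
  case 0
  then show ?case
  proof (induction R)
    case 0
    have "(\<Sum>i\<le>N. fact i * (m choose i) * Stirling (Suc 0) (Suc i)) =
        (\<Sum>i\<le>N. if i = 0 then 1 else 0)"
      by (intro sum.cong) auto
    then show ?case by (simp add: sum.delta)
  next
    case (Suc R)
    then show ?case using sum_Stirling_rec[of R N 0 m] by simp
  qed
next
  case (Suc k)
  note outer = Suc.IH
  from Suc.prems show ?case
  proof (induction R)
    case 0
    have "(\<Sum>i\<le>N. fact (i + Suc k) * (m choose i) * Stirling (Suc (Suc k)) (i + Suc (Suc k))) =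
        (\<Sum>i\<le>N. if i = 0 then fact (Suc k) else 0)"
      by (intro sum.cong) (auto simp del: Stirling.simps)
    then show ?case by (simp add: sum.delta del: Stirling.simps)
  next
    case (Suc R)
    have "(\<Sum>i\<le>N. fact (i + Suc k) * (m choose i)
          * Stirling (Suc (Suc k) + Suc R) (i + Suc (Suc k)))
        = Suc k * (\<Sum>i\<le>N. fact (i + k) * (m choose i) * Stirling (Suc k + Suc R) (i + Suc k))
          + (m + Suc k + 1) * (\<Sum>i\<le>N. fact (i + Suc k) * (m choose i)
              * Stirling (Suc (Suc k) + R) (i + Suc (Suc k)))"
      using sum_Stirling_rec[of R N "Suc k" m] Suc.prems by (simp del: Stirling.simps)
    also have "\<dots> = Suc k * (fact k * complete_hom (\<lambda>i. m + 1 + i) (Suc k) (Suc R))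
        + (m + Suc k + 1) * (fact (Suc k) * complete_hom (\<lambda>i. m + 1 + i) (Suc (Suc k)) R)"
      using outer[OF Suc.prems] Suc.IH Suc.prems by simp
    also have "\<dots> = fact (Suc k) * complete_hom (\<lambda>i. m + 1 + i) (Suc (Suc k)) (Suc R)"
      by (simp add: algebra_simps)
    finally show ?case .
  qed
qed

corollary normalized_sum_Stirling_eq_complete_hom:
  assumes "R \<le> N" "1 \<le> k"
  shows "1 / fact (k - 1) *
      (\<Sum>i = 0..N. fact (i + k - 1) * real (m choose i) * real (Stirling (k + R) (i + k)))
    = real (complete_hom (\<lambda>i. m + 1 + i) k R)"
proof -
  obtain k' where k: "k = Suc k'" using assms by (cases k) auto
  have "(\<Sum>i\<le>N. fact (i + k') * real (m choose i) * real (Stirling (Suc k' + R) (i + Suc k')))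
      = real (\<Sum>i\<le>N. fact (i + k') * (m choose i) * Stirling (Suc k' + R) (i + Suc k'))"
    by (simp del: Stirling.simps)
  also have "\<dots> = fact k' * real (complete_hom (\<lambda>i. m + 1 + i) (Suc k') R)"
    by (simp only: sum_Stirling_eq_complete_hom[OF assms(1)] of_nat_mult of_nat_fact)
  finally show ?thesis
    by (simp add: k atLeast0AtMost del: Stirling.simps complete_hom.simps)
qed

theorem lemma8:
  fixes j k n r :: nat
  assumes "1 \<le> j" and "j < k" and "k \<le> n" and "1 \<le> r"
  shows "1 / fact (k - 1) *
      (\<Sum>i = 0..r + 1. fact (i + k - 1) * real ((n - k) choose i) * real (Stirling (k + r + 1) (i + k)))
    = 1 / fact (k - j - 1) *
      (\<Sum>i = 0..r + 1. fact (k - j - 1 + i) * real ((n - k + j) choose i) *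
        (\<Sum>l = k - 2..k + r - 1. real (Stirling (l + 2 - j) (k - j + i)) *
          (\<Sum>s = 0..k + r - l - 1.
            real ((n - k) choose s) * (fact (s + j - 1) / fact (j - 1)) *
            real (Stirling (j + k + r - l - 1) (s + j)))))"
proof -
  define m where "m = n - k"
  define a where "a = k - j"
  define R where "R = r + 1"
  have a: "1 \<le> a" and k: "k = j + a" using assms by (auto simp: a_def)
  let ?h = "\<lambda>t. real (complete_hom (\<lambda>i. m + j + 1 + i) a t)"
  let ?g = "\<lambda>u. real (complete_hom (\<lambda>i. m + 1 + i) j u)"
  let ?c = "\<lambda>i. fact (i + a - 1) * real ((m + j) choose i)"
  have inner: "(\<Sum>s = 0..k + r - l - 1.
            real ((n - k) choose s) * (fact (s + j - 1) / fact (j - 1)) *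
            real (Stirling (j + k + r - l - 1) (s + j))) = ?g (R - t)"
    if "l = k - 2 + t" "t \<le> R" for l t
  proof -
    have "k + r - l - 1 = R - t" "j + k + r - l - 1 = j + (R - t)"
      using that assms by (auto simp: R_def)
    then show ?thesis
      using normalized_sum_Stirling_eq_complete_hom[of "R - t" "R - t" j m] assms
      by (simp add: m_def sum_distrib_left algebra_simps)
  qed
  have reindex: "(\<Sum>l = k - 2..k + r - 1. f l) = (\<Sum>t\<le>R. f (k - 2 + t))" for f :: "nat \<Rightarrow> real"
    by (rule sum.reindex_bij_witness[of _ "\<lambda>t. k - 2 + t" "\<lambda>l. l - (k - 2)"])
       (use assms in \<open>auto simp: R_def\<close>)
  have middle: "(\<Sum>l = k - 2..k + r - 1. real (Stirling (l + 2 - j) (k - j + i)) *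
          (\<Sum>s = 0..k + r - l - 1.
            real ((n - k) choose s) * (fact (s + j - 1) / fact (j - 1)) *
            real (Stirling (j + k + r - l - 1) (s + j))))
      = (\<Sum>t\<le>R. real (Stirling (a + t) (i + a)) * ?g (R - t))" for i
    unfolding reindex
  proof (intro sum.cong refl)
    fix t assume "t \<in> {..R}"
    moreover have "k - 2 + t + 2 - j = a + t" "k - j + i = i + a" using assms by (auto simp: a_def)
    ultimately show "real (Stirling (k - 2 + t + 2 - j) (k - j + i)) *
          (\<Sum>s = 0..k + r - (k - 2 + t) - 1.
            real ((n - k) choose s) * (fact (s + j - 1) / fact (j - 1)) *
            real (Stirling (j + k + r - (k - 2 + t) - 1) (s + j)))
        = real (Stirling (a + t) (i + a)) * ?g (R - t)"
      by (simp only: inner[OF refl] atMost_iff)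
  qed
  have bounds: "k - j - 1 = a - 1" "a - 1 + i = i + a - 1" for i
    using a by (auto simp: a_def)
  have "1 / fact (k - j - 1) *
      (\<Sum>i = 0..r + 1. fact (k - j - 1 + i) * real ((n - k + j) choose i) *
        (\<Sum>l = k - 2..k + r - 1. real (Stirling (l + 2 - j) (k - j + i)) *
          (\<Sum>s = 0..k + r - l - 1.
            real ((n - k) choose s) * (fact (s + j - 1) / fact (j - 1)) *
            real (Stirling (j + k + r - l - 1) (s + j)))))
    = 1 / fact (a - 1) * (\<Sum>i = 0..R. ?c i *
        (\<Sum>t\<le>R. real (Stirling (a + t) (i + a)) * ?g (R - t)))"
    by (simp only: middle) (simp only: m_def[symmetric] R_def[symmetric] bounds)
  also have "\<dots> = 1 / fact (a - 1) *
      (\<Sum>t\<le>R. \<Sum>i = 0..R. ?c i * (real (Stirling (a + t) (i + a)) * ?g (R - t)))"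
    by (simp only: sum_distrib_left sum.swap[of _ "{..R}"])
  also have "\<dots> = (\<Sum>t\<le>R. (1 / fact (a - 1) *
      (\<Sum>i = 0..R. ?c i * real (Stirling (a + t) (i + a)))) * ?g (R - t))"
    by (simp only: sum_distrib_left sum_distrib_right mult.assoc)
  also have "\<dots> = (\<Sum>t\<le>R. ?h t * ?g (R - t))"
    using normalized_sum_Stirling_eq_complete_hom[of _ R a "m + j"] a
    by (intro sum.cong) simp_all
  also have "\<dots> = real (complete_hom (\<lambda>i. m + 1 + i) k R)"
    by (simp only: k complete_hom_add of_nat_sum of_nat_mult add.assoc add.left_commute[of j])
  also have "\<dots> = 1 / fact (k - 1) * (\<Sum>i = 0..r + 1.
      fact (i + k - 1) * real ((n - k) choose i) * real (Stirling (k + r + 1) (i + k)))"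
    using normalized_sum_Stirling_eq_complete_hom[of R R k m] assms
    by (simp add: R_def m_def)
  finally show ?thesis by (rule sym)
qed

end
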